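(* Let $S$ be the positive cone of an $L$-ordered group $(G;e,+,0)$. Then $S$ has the following properties: (i) $S(x)\wedge S(y)\le S(x+y)$ for all $x,y\in G$; (ii) for all $x\in G$, $S(x)=S(-x)=1$ implies $x=0$; (iii) $S(0)=1$, and $S(x+y-x)=S(y)$ for all $x,y\in G$; (iv) $S$ is convex. Moreover, if $(G;+,0)$ is a group and $S:G\to L$ is a map satisfying properties (i), (ii) and (iii), then there exists a map $f:G\times G\to L$ such that $(G;f,+,0)$ is an $L$-ordered group and $S$ is convex in this $L$-ordered group.
   Context: $L$ is a fixed frame, i.e. a complete lattice (bottom $0$, top $1$) with $a\wedge\bigvee T=\bigvee_{t\in T}(a\wedge t)$ for all $a\in L$, $T\subseteq L$. An $L$-ordered set is a pair $(P;e)$ with $e:P\times P\to L$ such that for all $x,y,z\in P$: $e(x,x)=1$; $e(x,y)\wedge e(y,z)\le e(x,z)$; and $e(x,y)=e(y,x)=1$ implies $x=y$. An $L$-ordered group $(G;e,+,0)$ is a (not necessarily abelian) group $(G;+,0)$, written additively, with an $L$-ordered set structure $(G;e)$ such that $e(x,y)\le e(b+x+a,b+y+a)$ for all $x,y,a,b\in G$. The positive cone of $(G;e,+,0)$ is the map $G\to L$, $x\mapsto e(0,x)$. A map $S:G\to L$ is convex in $(G;e,+,0)$ if $S(a)\ge S(x)\wedge S(y)\wedge e(x,a)\wedge e(a,y)$ for all $x,y,a\in G$. *)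

theory Defs
  imports Main
begin

unbundle lattice_syntax

text \<open>
  The library class \<^class>\<open>complete_distrib_lattice\<close> demands complete distributivity
  (arbitrary meets of arbitrary joins), which is strictly stronger than the frame law.
\<close>

class frame = complete_lattice +
  assumes inf_Sup_frame: "a \<sqinter> \<Squnion>T = (\<Squnion>t\<in>T. a \<sqinter> t)"

subclass (in complete_distrib_lattice) frame
  by standard (rule inf_Sup)

locale L_ordered_set =
  fixes e :: "'p \<Rightarrow> 'p \<Rightarrow> 'l::frame"
  assumes L_refl: "e x x = \<top>"
    and L_trans: "e x y \<sqinter> e y z \<le> e x z"
    and L_antisym: "e x y = \<top> \<Longrightarrow> e y x = \<top> \<Longrightarrow> x = y"

text \<open>Addition in \<^class>\<open>group_add\<close> is not assumed to be commutative.\<close>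

locale L_ordered_group = L_ordered_set e
  for e :: "'g::group_add \<Rightarrow> 'g \<Rightarrow> 'l::frame" +
  assumes translation: "e x y \<le> e (b + x + a) (b + y + a)"

definition positive_cone :: "('g::group_add \<Rightarrow> 'g \<Rightarrow> 'l::frame) \<Rightarrow> 'g \<Rightarrow> 'l"
  where "positive_cone e x = e 0 x"

definition L_convex :: "('g \<Rightarrow> 'g \<Rightarrow> 'l::frame) \<Rightarrow> ('g \<Rightarrow> 'l) \<Rightarrow> bool"
  where "L_convex e S \<longleftrightarrow> (\<forall>x y a. S x \<sqinter> S y \<sqinter> e x a \<sqinter> e a y \<le> S a)"

end

theory Submission
  imports Defs
begin

text \<open>
  A translation-invariant order is determined by its positive cone through
  \<open>e x y = e 0 (y - x)\<close>; conversely, \<open>f x y = S (y - x)\<close> is the order with positive cone \<open>S\<close>.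
\<close>

context L_ordered_group
begin

text \<open>Left translation by \<open>x\<close> carries the pair \<open>0\<close>, \<open>y\<close>
  to \<open>x\<close>, \<open>x + y\<close>, so transitivity along \<open>0\<close>,
  \<open>x\<close>, \<open>x + y\<close> applies.\<close>

lemma positive_cone_add:
  "positive_cone e x \<sqinter> positive_cone e y \<le> positive_cone e (x + y)"
proof -
  have "e 0 y \<le> e x (x + y)"
    using translation[of 0 y x 0] by simp
  then have "e 0 x \<sqinter> e 0 y \<le> e 0 x \<sqinter> e x (x + y)"
    by (intro inf_mono order_refl)
  also have "\<dots> \<le> e 0 (x + y)"
    by (rule L_trans)
  finally show ?thesis
    by (simp add: positive_cone_def)
qed

text \<open>Translating by \<open>x\<close> turns \<open>e 0 (- x)\<close> into a lower bound for
  \<open>e x 0\<close>, so antisymmetry applies to \<open>0\<close> and \<open>x\<close>.\<close>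

lemma positive_cone_eq_zero:
  assumes "positive_cone e x = \<top>" "positive_cone e (- x) = \<top>"
  shows "x = 0"
proof -
  have "e 0 (- x) \<le> e x 0"
    using translation[of 0 "- x" x 0] by simp
  then have "e x 0 = \<top>"
    using assms(2) by (simp add: positive_cone_def top_unique)
  then show ?thesis
    using assms(1) L_antisym by (simp add: positive_cone_def)
qed

lemma positive_cone_zero: "positive_cone e 0 = \<top>"
  by (simp add: positive_cone_def L_refl)

text \<open>Conjugation by \<open>x\<close> is a two-sided translation that fixes \<open>0\<close>,
  so it cannot decrease \<open>e 0 y\<close>; conjugating back by \<open>- x\<close> gives the other
  inequality.\<close>

lemma positive_cone_conjugate: "positive_cone e (x + y - x) = positive_cone e y"
proof (rule antisym)
  have "- x + (x + y - x) + x = y"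
    by (simp only: add.assoc diff_add_cancel minus_add_cancel)
  then show "positive_cone e (x + y - x) \<le> positive_cone e y"
    using translation[of 0 "x + y - x" "- x" x] by (simp add: positive_cone_def)
  show "positive_cone e y \<le> positive_cone e (x + y - x)"
    using translation[of 0 y x "- x"] by (simp add: positive_cone_def)
qed

text \<open>The cone is upward closed: transitivity along \<open>0\<close>, \<open>x\<close>,
  \<open>a\<close> bounds \<open>e 0 x \<sqinter> e x a\<close> by \<open>e 0 a\<close>.\<close>

lemma L_convex_positive_cone: "L_convex e (positive_cone e)"
  unfolding L_convex_def positive_cone_def
proof (intro allI)
  fix x y a
  have "e 0 x \<sqinter> e 0 y \<sqinter> e x a \<sqinter> e a y \<le> e 0 x \<sqinter> e x a"
    by (simp add: le_infI1)
  also have "\<dots> \<le> e 0 a"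
    by (rule L_trans)
  finally show "e 0 x \<sqinter> e 0 y \<sqinter> e x a \<sqinter> e a y \<le> e 0 a" .
qed

end

definition cone_order :: "('g::group_add \<Rightarrow> 'l::frame) \<Rightarrow> 'g \<Rightarrow> 'g \<Rightarrow> 'l"
  where "cone_order S x y = S (y - x)"

text \<open>Each property of \<open>S\<close> yields one axiom: \<open>zero\<close> reflexivity,
  \<open>add\<close> transitivity, \<open>eq_zero\<close> antisymmetry, \<open>conjugate\<close>
  translation invariance.\<close>

lemma L_ordered_group_cone_order:
  fixes S :: "'g::group_add \<Rightarrow> 'l::frame"
  assumes add: "\<And>x y. S x \<sqinter> S y \<le> S (x + y)"
    and eq_zero: "\<And>x. S x = \<top> \<Longrightarrow> S (- x) = \<top> \<Longrightarrow> x = 0"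
    and zero: "S 0 = \<top>"
    and conjugate: "\<And>x y. S (x + y - x) = S y"
  shows "L_ordered_group (cone_order S)"
proof
  fix x y z a b :: 'g
  show "cone_order S x x = \<top>"
    by (simp add: cone_order_def zero)
  show "cone_order S x y \<sqinter> cone_order S y z \<le> cone_order S x z"
    \<comment> \<open>The summands must come in this order to telescope to \<open>z - x\<close>, as
      the group need not be commutative; the meet is commuted to match.\<close>
    using add[of "z - y" "y - x"] by (simp add: cone_order_def inf_commute add_diff_eq)
  show "x = y" if "cone_order S x y = \<top>" "cone_order S y x = \<top>"
    \<comment> \<open>Here \<open>x - y\<close> is the negative of \<open>y - x\<close>, so
      \<open>eq_zero\<close> forces \<open>y - x = 0\<close>.\<close>
    using that eq_zero[of "y - x"] by (simp add: cone_order_def)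
  \<comment> \<open>In the difference the right translation by \<open>a\<close> cancels, while the
    left translation by \<open>b\<close> survives as a conjugation, under which \<open>S\<close> is
    invariant. The two values of \<open>cone_order S\<close> are therefore equal.\<close>
  have "b + y + a - (b + x + a) = b + (y - x) - b"
    by (simp add: diff_conv_add_uminus minus_add add.assoc
        del: add_uminus_conv_diff)
  then show "cone_order S x y \<le> cone_order S (b + x + a) (b + y + a)"
    by (simp only: cone_order_def conjugate order_refl)
qed

text \<open>Writing \<open>a = (a - x) + x\<close>, additivity bounds
  \<open>S (a - x) \<sqinter> S x\<close> by \<open>S a\<close>.\<close>

lemma L_convex_cone_order:
  assumes add: "\<And>x y. S x \<sqinter> S y \<le> S (x + y)"
  shows "L_convex (cone_order S) S"
  unfolding L_convex_def cone_order_def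
proof (intro allI)
  fix x y a
  have "S x \<sqinter> S y \<sqinter> S (a - x) \<sqinter> S (y - a) \<le> S (a - x) \<sqinter> S x"
    by (simp add: le_infI1)
  also have "\<dots> \<le> S a"
    using add[of "a - x" x] by simp
  finally show "S x \<sqinter> S y \<sqinter> S (a - x) \<sqinter> S (y - a) \<le> S a" .
qed

theorem theorem4p17:
  shows
    "(\<forall>(e :: 'g::group_add \<Rightarrow> 'g \<Rightarrow> 'l::frame) (S :: 'g \<Rightarrow> 'l).
        L_ordered_group e \<and> S = positive_cone e \<longrightarrow>
          (\<forall>x y. S x \<sqinter> S y \<le> S (x + y)) \<and>
          (\<forall>x. S x = \<top> \<and> S (- x) = \<top> \<longrightarrow> x = 0) \<and>
          (S 0 = \<top> \<and> (\<forall>x y. S (x + y - x) = S y)) \<and>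
          L_convex e S) \<and>
     (\<forall>S :: 'g \<Rightarrow> 'l.
        (\<forall>x y. S x \<sqinter> S y \<le> S (x + y)) \<and>
        (\<forall>x. S x = \<top> \<and> S (- x) = \<top> \<longrightarrow> x = 0) \<and>
        (S 0 = \<top> \<and> (\<forall>x y. S (x + y - x) = S y)) \<longrightarrow>
          (\<exists>f :: 'g \<Rightarrow> 'g \<Rightarrow> 'l. L_ordered_group f \<and> L_convex f S))"
proof (intro conjI)
  show "\<forall>(e :: 'g \<Rightarrow> 'g \<Rightarrow> 'l) S.
      L_ordered_group e \<and> S = positive_cone e \<longrightarrow>
        (\<forall>x y. S x \<sqinter> S y \<le> S (x + y)) \<and>
        (\<forall>x. S x = \<top> \<and> S (- x) = \<top> \<longrightarrow> x = 0) \<and>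
        (S 0 = \<top> \<and> (\<forall>x y. S (x + y - x) = S y)) \<and>
        L_convex e S"
    by (blast intro: L_ordered_group.positive_cone_add L_ordered_group.positive_cone_eq_zero
        L_ordered_group.positive_cone_zero L_ordered_group.positive_cone_conjugate
        L_ordered_group.L_convex_positive_cone)
  show "\<forall>S :: 'g \<Rightarrow> 'l.
      (\<forall>x y. S x \<sqinter> S y \<le> S (x + y)) \<and>
      (\<forall>x. S x = \<top> \<and> S (- x) = \<top> \<longrightarrow> x = 0) \<and>
      (S 0 = \<top> \<and> (\<forall>x y. S (x + y - x) = S y)) \<longrightarrow>
        (\<exists>f :: 'g \<Rightarrow> 'g \<Rightarrow> 'l. L_ordered_group f \<and> L_convex f S)"
    using L_ordered_group_cone_order L_convex_cone_order by metis
qed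

end
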